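(* Let $q$ be an odd prime power, $d\ge2$, $Q$ a nondegenerate quadratic form on $\mathbb F_q^d$, $P\subseteq\mathbb F_q^d$ nonempty and $\mathcal S$ a nonempty family of distinct $Q$-spheres. Let $\mu=1-\frac{I(P,\mathcal S)}{|P||\mathcal S|}$. Then $$\mu\le\operatorname{dist}_{\mathrm{lin}}(P,\mathcal S).$$ If $\mu<(d+1)/(d+2)^2$, then $$\operatorname{dist}_{\mathrm{lin}}(P,\mathcal S)\le2\sqrt{(d+1)\mu}.$$ Moreover, if $\eta$ is a real number with $$\sigma(P,\mathcal S)\ge(1-\eta)(1-q^{-1})|P||\mathcal S|,$$ then $\mu\le\eta(1-q^{-1})$, and whenever $0<\eta(1-q^{-1})<\frac{d+1}{(d+2)^2}$, $$\operatorname{dist}_{\mathrm{lin}}(P,\mathcal S)\le2\sqrt{(d+1)\eta(1-q^{-1})}.$$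
   Context: Put $\langle x,y\rangle_Q=\frac{Q(x+y)-Q(x)-Q(y)}2$. For $c\in\mathbb F_q^d$, $r\in\mathbb F_q$ the $Q$-sphere is $S_Q(c,r)=\{x\in\mathbb F_q^d:Q(x-c)=r\}$; spheres are parametrized by pairs $(c,r)$ and distinct spheres means distinct parameter pairs. $I(P,\mathcal S)=|\{(p,S)\in P\times\mathcal S:p\in S\}|$ and $\sigma(P,\mathcal S)=I(P,\mathcal S)-|P||\mathcal S|/q$. The lift is $\Phi(S_Q(c,r))=(2c,r-Q(c))\in\mathbb F_q^{d+1}$. For $x\in\mathbb F_q^d$, $y=(u,a)\in\mathbb F_q^d\times\mathbb F_q$ put $\Lambda_x(y)=Q(x)-\langle x,u\rangle_Q-a$. For a (nonempty) affine subspace $L\subseteq\mathbb F_q^{d+1}$ put $\mathcal S(L)=\Phi^{-1}(L)$ and $B(L)=\{x\in\mathbb F_q^d:\Lambda_x(y)=0\ \forall y\in L\}$. The distance from a lifted-linear model is $$\operatorname{dist}_{\mathrm{lin}}(P,\mathcal S)=\inf_{L:\,B(L)\ne\varnothing}\left(\frac{|P\setminus B(L)|}{|P|}+\frac{|\mathcal S\setminus\mathcal S(L)|}{|\mathcal S|}\right),$$ the infimum being over affine subspaces $L\subseteq\mathbb F_q^{d+1}$ with $B(L)\neq\varnothing$. *)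

theory Defs
  imports "HOL-Analysis.Analysis" "HOL-Computational_Algebra.Primes"
begin

definition qinner :: "('a::field ^ 'n \<Rightarrow> 'a) \<Rightarrow> 'a ^ 'n \<Rightarrow> 'a ^ 'n \<Rightarrow> 'a" where
  "qinner Q x y = (Q (x + y) - Q x - Q y) / 2"

text \<open>
  Division by 2 in \<^const>\<open>qinner\<close> is the field's total division, so the notions below are
  meaningful in odd characteristic only.
\<close>

definition quadratic_form :: "('a::field ^ 'n \<Rightarrow> 'a) \<Rightarrow> bool" where
  "quadratic_form Q \<longleftrightarrow>
     (\<forall>c x. Q (c *s x) = c\<^sup>2 * Q x) \<and>
     (\<forall>x. Vector_Spaces.linear (*s) (*) (\<lambda>y. qinner Q x y)) \<and>
     (\<forall>y. Vector_Spaces.linear (*s) (*) (\<lambda>x. qinner Q x y))"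

definition nondegenerate_form :: "('a::field ^ 'n \<Rightarrow> 'a) \<Rightarrow> bool" where
  "nondegenerate_form Q \<longleftrightarrow> (\<forall>x. (\<forall>y. qinner Q x y = 0) \<longrightarrow> x = 0)"

definition Qsphere :: "('a::field ^ 'n \<Rightarrow> 'a) \<Rightarrow> 'a ^ 'n \<Rightarrow> 'a \<Rightarrow> ('a ^ 'n) set" where
  "Qsphere Q c r = {x. Q (x - c) = r}"

text \<open>
  A family of distinct spheres is a set of parameter pairs \<open>(c, r)\<close>, not a set of point sets:
  spheres with different parameters count as different even if they have the same points.
\<close>

definition incidences :: "('a::field ^ 'n \<Rightarrow> 'a) \<Rightarrow> ('a ^ 'n) set \<Rightarrow> (('a ^ 'n) \<times> 'a) set \<Rightarrow> nat" where
  "incidences Q P S = card {(p, s) \<in> P \<times> S. p \<in> Qsphere Q (fst s) (snd s)}"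

definition discrepancy ::
    "('a::finite_field ^ 'n \<Rightarrow> 'a) \<Rightarrow> ('a ^ 'n) set \<Rightarrow> (('a ^ 'n) \<times> 'a) set \<Rightarrow> real" where
  "discrepancy Q P S =
     real (incidences Q P S) - real (card P) * real (card S) / real CARD('a)"

definition lift_sphere :: "('a::field ^ 'n \<Rightarrow> 'a) \<Rightarrow> ('a ^ 'n) \<times> 'a \<Rightarrow> ('a ^ 'n) \<times> 'a" where
  "lift_sphere Q = (\<lambda>(c, r). (2 *s c, r - Q c))"

definition Lam :: "('a::field ^ 'n \<Rightarrow> 'a) \<Rightarrow> 'a ^ 'n \<Rightarrow> ('a ^ 'n) \<times> 'a \<Rightarrow> 'a" where
  "Lam Q x = (\<lambda>(u, a). Q x - qinner Q x u - a)"

text \<open>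
  The lifted space of dimension \<open>d + 1\<close> is the product type \<open>('a ^ 'n) \<times> 'a\<close> with the componentwise
  scalar multiplication over \<open>'a\<close>. The library's \<open>affine\<close> is restricted to real vector spaces.
\<close>

interpretation lifted: vector_space_prod
  "(*s) :: 'a::field \<Rightarrow> 'a ^ 'n \<Rightarrow> 'a ^ 'n" "(*) :: 'a \<Rightarrow> 'a \<Rightarrow> 'a"
  by unfold_locales

definition affine_subspace :: "(('a::field ^ 'n) \<times> 'a) set \<Rightarrow> bool" where
  "affine_subspace L \<longleftrightarrow> (\<exists>y W. lifted.p.subspace W \<and> L = (\<lambda>w. y + w) ` W)"

definition spheres_of ::
    "('a::field ^ 'n \<Rightarrow> 'a) \<Rightarrow> (('a ^ 'n) \<times> 'a) set \<Rightarrow> (('a ^ 'n) \<times> 'a) set" where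
  "spheres_of Q L = lift_sphere Q -` L"

definition base_locus :: "('a::field ^ 'n \<Rightarrow> 'a) \<Rightarrow> (('a ^ 'n) \<times> 'a) set \<Rightarrow> ('a ^ 'n) set" where
  "base_locus Q L = {x. \<forall>y\<in>L. Lam Q x y = 0}"

definition dist_lin ::
    "('a::finite_field ^ 'n \<Rightarrow> 'a) \<Rightarrow> ('a ^ 'n) set \<Rightarrow> (('a ^ 'n) \<times> 'a) set \<Rightarrow> real" where
  "dist_lin Q P S =
     (INF L \<in> {L. affine_subspace L \<and> base_locus Q L \<noteq> {}}.
        real (card (P - base_locus Q L)) / real (card P) +
        real (card (S - spheres_of Q L)) / real (card S))"

text \<open>
  This infimum is taken in \<open>real\<close>, where it is only meaningful over a nonempty index set; singletons
  \<open>L\<close> ensure that.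
\<close>

lemma ex_affine_subspace_base_locus:
  fixes Q :: "'a::field ^ 'b \<Rightarrow> 'a"
  shows "\<exists>L. affine_subspace L \<and> base_locus Q L \<noteq> {}"
proof -
  let ?y = "(0, Q 0 - qinner Q 0 0)"
  have "lifted.p.subspace {0 :: ('a ^ 'b) \<times> 'a}" by (rule lifted.p.subspace_single_0)
  then have "affine_subspace {?y}"
    unfolding affine_subspace_def by (intro exI[of _ ?y] exI[of _ "{0}"]) simp
  moreover have "0 \<in> base_locus Q {?y}"
    by (simp add: base_locus_def Lam_def)
  ultimately show ?thesis by blast
qed

end

theory Submission
  imports Defs "HOL-Number_Theory.Residues"
begin

text \<open>
  Since \<open>\<Lambda>\<^sub>p(\<Phi>(S\<^sub>Q(c,r))) = Q(p - c) - r\<close>, every non-incidence lies in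
  \<open>(P - B(L)) \<times> S \<union> P \<times> (S - S(L))\<close>, which is the lower bound. For the upper bound, let \<open>A\<close> be the
  set of points of \<open>P\<close> missing at most a fraction \<open>t\<close> of the spheres. The vanishing of \<open>\<Lambda>\<^sub>p\<close> on all of
  \<open>A\<close> is implied by its vanishing on some \<open>d + 2\<close> points of \<open>A\<close>; as \<open>(d + 2) t < 1\<close>, these have a common
  sphere. Once a common zero is known, \<open>d + 1\<close> points suffice, so the common zero set \<open>L\<close> contains all
  but a fraction \<open>(d + 1) t\<close> of the lifted spheres, while Markov's inequality gives
  \<open>|P - A| \<le> \<mu> |P| / t\<close>. The choice \<open>t = sqrt (\<mu> / (d + 1))\<close> is optimal.
\<close>

section \<open>Linear algebra and characteristic\<close>

lemma vanishing_determined_by_few: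
  fixes v :: "'p \<Rightarrow> 'a::field ^ 'm"
  obtains T where "T \<subseteq> A" "finite T" "card T \<le> CARD('m)"
    "\<And>w. \<forall>p\<in>T. (\<Sum>i\<in>UNIV. v p $ i * w i) = 0 \<Longrightarrow> \<forall>p\<in>A. (\<Sum>i\<in>UNIV. v p $ i * w i) = 0"
proof -
  obtain B where B: "B \<subseteq> v ` A" "vec.independent B" "v ` A \<subseteq> vec.span B" "card B = vec.dim (v ` A)"
    by (rule vec.basis_exists)
  from B(1) obtain T where T: "T \<subseteq> A" "inj_on v T" "B = v ` T"
    by (auto simp: subset_image_inj)
  have "finite B" using B(2) by (rule vec.finiteI_independent)
  then have "finite T" using T finite_image_iff by blast
  moreover have "card T \<le> CARD('m)"
    using B(4) T dim_subset_UNIV_cart_gen[of "v ` A"] by (simp add: card_image)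
  moreover have "\<forall>p\<in>A. (\<Sum>i\<in>UNIV. v p $ i * w i) = 0"
    if "\<forall>p\<in>T. (\<Sum>i\<in>UNIV. v p $ i * w i) = 0" for w
  proof -
    have "vec.subspace {x. (\<Sum>i\<in>UNIV. x $ i * w i) = 0}"
      by (rule vec.subspaceI)
        (simp_all add: distrib_right sum.distrib mult.assoc flip: sum_distrib_left)
    moreover have "B \<subseteq> {x. (\<Sum>i\<in>UNIV. x $ i * w i) = 0}"
      using that T(3) by auto
    ultimately have "vec.span B \<subseteq> {x. (\<Sum>i\<in>UNIV. x $ i * w i) = 0}"
      by (rule vec.span_minimal[rotated])
    with B(3) show ?thesis by auto
  qed
  ultimately show thesis using that T(1) by blast
qed

lemma sum_UNIV_option:
  "(\<Sum>i\<in>UNIV. f i) = f None + (\<Sum>i\<in>UNIV. f (Some i))" for f :: "'n::finite option \<Rightarrow> 'b::comm_monoid_add"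
  by (simp add: UNIV_option_conv sum.reindex)

lemma two_neq_zero_if_odd_card:
  assumes "odd CARD('a::finite_field)"
  shows "(2::'a) \<noteq> 0"
proof
  assume "(2::'a) = 0"
  then have "of_nat 2 = (0::'a)" by simp
  then have "CHAR('a) dvd 2" by (simp only: of_nat_eq_0_iff_char_dvd)
  then have "CHAR('a) = 2"
    using primes_dvd_imp_eq[OF prime_CHAR_semidom two_is_prime_nat] CHAR_pos by blast
  then show False using CHAR_dvd_CARD[where 'a='a] assms by simp
qed

section \<open>\<open>Lam\<close> as a function of the lifted sphere\<close>

context
  fixes Q :: "'a::field ^ 'n \<Rightarrow> 'a"
  assumes Q: "quadratic_form Q"
begin

lemma linear_qinner_left: "Vector_Spaces.linear (*s) (*) (\<lambda>x. qinner Q x u)"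
  using Q by (simp add: quadratic_form_def)

lemma linear_qinner_right: "Vector_Spaces.linear (*s) (*) (qinner Q x)"
  using Q by (simp add: quadratic_form_def)

lemma qinner_expand: "qinner Q x u = (\<Sum>i\<in>UNIV. x $ i * qinner Q (axis i 1) u)"
proof -
  interpret l: Vector_Spaces.linear "(*s)" "(*)" "\<lambda>x. qinner Q x u"
    by (rule linear_qinner_left)
  have "qinner Q x u = qinner Q (\<Sum>i\<in>UNIV. x $ i *s axis i 1) u"
    by (simp add: basis_expansion)
  then show ?thesis by (simp only: l.sum l.scale)
qed

lemma qinner_add_right: "qinner Q x (y + z) = qinner Q x y + qinner Q x z"
  and qinner_scale_right: "qinner Q x (k *s y) = k * qinner Q x y"
proof -
  interpret l: Vector_Spaces.linear "(*s)" "(*)" "qinner Q x"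
    by (rule linear_qinner_right)
  show "qinner Q x (y + z) = qinner Q x y + qinner Q x z" by (rule l.add)
  show "qinner Q x (k *s y) = k * qinner Q x y" by (rule l.scale)
qed

lemma qinner_zero_right: "qinner Q x 0 = 0"
  using qinner_scale_right[of x 0 0] by simp

lemma Lam_add: "Lam Q x (y + w) = Lam Q x y - (qinner Q x (fst w) + snd w)"
  by (simp add: Lam_def split_beta qinner_add_right)

text \<open>Polarization gives \<open>Q (p - c) = Q p - 2 * qinner Q p c + Q c\<close>; the factor 2
  in the lift matches the cross term, and \<open>Q c\<close> cancels.\<close>

lemma Lam_lift_sphere:
  assumes "(2::'a) \<noteq> 0"
  shows "Lam Q p (lift_sphere Q s) = 0 \<longleftrightarrow> p \<in> Qsphere Q (fst s) (snd s)"
proof -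
  have neg: "- fst s = (-1) *s fst s" by (simp add: vec_eq_iff)
  have "Q ((-1) *s fst s) = (-1)\<^sup>2 * Q (fst s)"
    using Q unfolding quadratic_form_def by blast
  then have "Q (- fst s) = Q (fst s)"
    unfolding neg by simp
  moreover have "qinner Q p (- fst s) = - qinner Q p (fst s)"
    unfolding neg by (simp only: qinner_scale_right) simp
  ultimately have "Q (p - fst s) = Q p + Q (fst s) - 2 * qinner Q p (fst s)"
    using assms by (simp add: qinner_def field_simps)
  then show ?thesis
    by (auto simp: Lam_def lift_sphere_def Qsphere_def split_beta qinner_scale_right algebra_simps)
qed

text \<open>The zero set is the translate by \<open>y0\<close> of the solutions of the homogeneous
  equations \<open>qinner Q p u + a = 0\<close>; \<open>y0\<close> keeps it from being
  empty.\<close>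

lemma affine_subspace_common_zeros:
  assumes "\<And>p. p \<in> A \<Longrightarrow> Lam Q p y0 = 0"
  shows "affine_subspace {y. \<forall>p\<in>A. Lam Q p y = 0}"
proof -
  let ?W = "{w. \<forall>p\<in>A. qinner Q p (fst w) + snd w = 0}"
  have "lifted.p.subspace ?W"
  proof (rule lifted.p.subspaceI)
    show "lifted.scale c w \<in> ?W" if "w \<in> ?W" for c w
      using that by (auto simp: lifted.scale_def qinner_scale_right simp flip: distrib_left)
  next
    fix v w assume "v \<in> ?W" "w \<in> ?W"
    then have "\<forall>p\<in>A. (qinner Q p (fst v) + snd v) + (qinner Q p (fst w) + snd w) = 0" by simp
    then show "v + w \<in> ?W" by (simp add: qinner_add_right algebra_simps)
  qed (simp add: qinner_zero_right)
  moreover have "{y. \<forall>p\<in>A. Lam Q p y = 0} = (\<lambda>w. y0 + w) ` ?W" (is "?L = _")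
  proof (intro equalityI subsetI)
    fix y assume "y \<in> ?L"
    then have "y - y0 \<in> ?W" using assms Lam_add[of _ y0 "y - y0"]
      by (auto simp: neg_eq_iff_add_eq_0 simp del: fst_diff snd_diff)
    then show "y \<in> (\<lambda>w. y0 + w) ` ?W" by (intro image_eqI[of _ _ "y - y0"]) simp_all
  qed (use assms in \<open>auto simp: Lam_add\<close>)
  ultimately show ?thesis unfolding affine_subspace_def by blast
qed

lemma Lam_determined_by_few:
  obtains T where "T \<subseteq> A" "finite T" "card T \<le> CARD('n) + 2"
    "\<And>y. \<forall>p\<in>T. Lam Q p y = 0 \<Longrightarrow> \<forall>p\<in>A. Lam Q p y = 0"
proof -
  \<comment> \<open>\<open>Lam Q p y\<close> is the dot product of a vector
    \<open>(1, Q p, p)\<close> with one depending only on \<open>y\<close>; the two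
    \<open>option\<close> layers supply the two extra coordinates.\<close>
  define v :: "'a ^ 'n \<Rightarrow> 'a ^ 'n option option" where
    "v p = (\<chi> i. case i of None \<Rightarrow> 1 | Some None \<Rightarrow> Q p | Some (Some j) \<Rightarrow> p $ j)" for p
  define w where
    "w y i = (case i of None \<Rightarrow> - snd y | Some None \<Rightarrow> 1 | Some (Some j) \<Rightarrow> - qinner Q (axis j 1) (fst y))"
    for y :: "('a ^ 'n) \<times> 'a" and i
  have vw: "(\<Sum>i\<in>UNIV. v p $ i * w y i) = Lam Q p y" for p y
    using qinner_expand[of p "fst y"]
    by (simp add: v_def w_def sum_UNIV_option Lam_def split_beta sum_negf)
  obtain T where "T \<subseteq> A" "finite T" "card T \<le> CARD('n option option)"
    and *: "\<And>w. \<forall>p\<in>T. (\<Sum>i\<in>UNIV. v p $ i * w i) = 0 \<Longrightarrow> \<forall>p\<in>A. (\<Sum>i\<in>UNIV. v p $ i * w i) = 0"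
    using vanishing_determined_by_few[of A v] by metis
  moreover have "\<forall>p\<in>A. Lam Q p y = 0" if "\<forall>p\<in>T. Lam Q p y = 0" for y
    using that *[of "w y"] by (simp add: vw)
  ultimately show thesis by (intro that[of T]) simp_all
qed

text \<open>
  A common zero \<open>(u\<^sub>0, a\<^sub>0)\<close> expresses \<open>Q p\<close> on \<open>A\<close> as an affine function of \<open>p\<close>, which saves a point.
\<close>

lemma Lam_determined_by_fewer:
  assumes y0: "\<And>p. p \<in> A \<Longrightarrow> Lam Q p y0 = 0"
  obtains T where "T \<subseteq> A" "finite T" "card T \<le> CARD('n) + 1"
    "\<And>y. \<forall>p\<in>T. Lam Q p y = 0 \<Longrightarrow> \<forall>p\<in>A. Lam Q p y = 0"
proof -
  define v :: "'a ^ 'n \<Rightarrow> 'a ^ 'n option" where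
    "v p = (\<chi> i. case i of None \<Rightarrow> 1 | Some j \<Rightarrow> p $ j)" for p
  define w where
    "w y i = (case i of None \<Rightarrow> - snd (y - y0) | Some j \<Rightarrow> - qinner Q (axis j 1) (fst (y - y0)))" for y i
  \<comment> \<open>Subtracting \<open>Lam Q p y0 = 0\<close> removes \<open>Q p\<close>, so its
    coordinate is dropped. The identity is available for \<open>p \<in> A\<close>, which contains
    \<open>T\<close>.\<close>
  have vw: "(\<Sum>i\<in>UNIV. v p $ i * w y i) = Lam Q p y" if "p \<in> A" for p y
    using qinner_expand[of p "fst (y - y0)"] Lam_add[of p y0 "y - y0"] y0[OF that]
    by (simp add: v_def w_def sum_UNIV_option sum_negf)
  obtain T where "T \<subseteq> A" "finite T" "card T \<le> CARD('n option)"
    and *: "\<And>w. \<forall>p\<in>T. (\<Sum>i\<in>UNIV. v p $ i * w i) = 0 \<Longrightarrow> \<forall>p\<in>A. (\<Sum>i\<in>UNIV. v p $ i * w i) = 0"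
    using vanishing_determined_by_few[of A v] by metis
  moreover have "\<forall>p\<in>A. Lam Q p y = 0" if "\<forall>p\<in>T. Lam Q p y = 0" for y
    using that *[of "w y"] \<open>T \<subseteq> A\<close> by (auto simp: vw subset_iff)
  ultimately show thesis by (intro that[of T]) simp_all
qed

end

section \<open>Counting missed spheres\<close>

definition missed :: "('a::field ^ 'n \<Rightarrow> 'a) \<Rightarrow> (('a ^ 'n) \<times> 'a) set \<Rightarrow> 'a ^ 'n \<Rightarrow> (('a ^ 'n) \<times> 'a) set" where
  "missed Q S p = {s \<in> S. Lam Q p (lift_sphere Q s) \<noteq> 0}"

text \<open>Union bound over \<open>T\<close>.\<close>

lemma card_missed_by_some_le:
  fixes t :: real
  assumes "finite T" "0 \<le> t" "card T \<le> k" "\<And>p. p \<in> T \<Longrightarrow> card (missed Q S p) \<le> t * card S"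
  shows "card (\<Union>p\<in>T. missed Q S p) \<le> k * t * card S"
proof -
  have "real (card (\<Union>p\<in>T. missed Q S p)) \<le> (\<Sum>p\<in>T. real (card (missed Q S p)))"
    using card_UN_le[OF assms(1), of "missed Q S"] by (metis of_nat_mono of_nat_sum)
  also have "\<dots> \<le> (\<Sum>p\<in>T. t * card S)"
    by (intro sum_mono assms)
  also have "\<dots> = card T * (t * card S)" by simp
  also have "\<dots> \<le> k * (t * card S)"
    using assms by (intro mult_right_mono) auto
  finally show ?thesis by (simp add: mult.assoc)
qed

context
  fixes Q :: "'a::finite_field ^ 'n \<Rightarrow> 'a"
    and P :: "('a ^ 'n) set"
    and S :: "(('a ^ 'n) \<times> 'a) set"
  assumes Q: "quadratic_form Q" and P: "P \<noteq> {}" and S: "S \<noteq> {}"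
begin

lemma card_P: "0 < card P" and card_S: "0 < card S"
  using P S by (simp_all add: card_gt_0_iff)

text \<open>The sum counts non-incident pairs, the complement of the incidences in
  \<open>P \<times> S\<close>. Odd characteristic enters here, to identify zeros of
  \<open>Lam\<close> with incidences.\<close>

lemma sum_card_missed:
  assumes "odd CARD('a)"
  shows "(\<Sum>p\<in>P. real (card (missed Q S p))) = real (card P) * real (card S) - real (incidences Q P S)"
proof -
  let ?I = "{(p, s) \<in> P \<times> S. p \<in> Qsphere Q (fst s) (snd s)}"
  note two = two_neq_zero_if_odd_card[OF assms]
  have "(SIGMA p:P. missed Q S p) = P \<times> S - ?I"
    by (auto simp: missed_def Lam_lift_sphere[OF Q two])
  moreover have "card (P \<times> S - ?I) = card (P \<times> S) - card ?I"
    by (rule card_Diff_subset) auto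
  moreover have "card ?I \<le> card (P \<times> S)"
    by (rule card_mono) auto
  ultimately have "real (card (SIGMA p:P. missed Q S p)) = real (card P) * real (card S) - real (incidences Q P S)"
    by (simp add: incidences_def of_nat_diff card_cartesian_product)
  then show ?thesis by (simp add: card_SigmaI)
qed

section \<open>The lower and upper bounds for the distance\<close>

lemma dist_lin_lower:
  "(\<Sum>p\<in>P. real (card (missed Q S p))) / (card P * card S) \<le> dist_lin Q P S"
  unfolding dist_lin_def
proof (rule cINF_greatest)
  show "{L. affine_subspace L \<and> base_locus Q L \<noteq> {}} \<noteq> {}"
    using ex_affine_subspace_base_locus[of Q] by blast
  fix L :: "(('a ^ 'n) \<times> 'a) set"
  let ?B = "P - base_locus Q L" and ?C = "S - spheres_of Q L"
  \<comment> \<open>If \<open>p\<close> lies in the base locus and \<open>s\<close> lifts into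
    \<open>L\<close>, then \<open>Lam\<close> vanishes on the pair, so \<open>s\<close> is not
    missed by \<open>p\<close>.\<close>
  have "(SIGMA p:P. missed Q S p) \<subseteq> ?B \<times> S \<union> P \<times> ?C"
    by (auto simp: missed_def base_locus_def spheres_of_def)
  then have "card (SIGMA p:P. missed Q S p) \<le> card (?B \<times> S \<union> P \<times> ?C)"
    by (intro card_mono) auto
  also have "\<dots> \<le> card ?B * card S + card P * card ?C"
    using card_Un_le[of "?B \<times> S" "P \<times> ?C"] by (simp add: card_cartesian_product)
  finally have "(\<Sum>p\<in>P. card (missed Q S p)) \<le> card ?B * card S + card P * card ?C"
    by (simp add: card_SigmaI)
  then have "(\<Sum>p\<in>P. real (card (missed Q S p))) \<le> real (card ?B) * card S + real (card P) * card ?C"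
    by (metis (mono_tags, lifting) of_nat_add of_nat_mono of_nat_mult of_nat_sum sum.cong)
  then have "(\<Sum>p\<in>P. real (card (missed Q S p))) / (card P * card S)
      \<le> (real (card ?B) * card S + real (card P) * card ?C) / (card P * card S)"
    by (rule divide_right_mono) simp
  also have "\<dots> = real (card ?B) / real (card P) + real (card ?C) / real (card S)"
    using P S by (simp add: add_divide_distrib)
  finally show "(\<Sum>p\<in>P. real (card (missed Q S p))) / (card P * card S)
      \<le> real (card ?B) / real (card P) + real (card ?C) / real (card S)" .
qed

lemma dist_lin_le:
  assumes "affine_subspace L" "base_locus Q L \<noteq> {}"
  shows "dist_lin Q P S \<le> card (P - base_locus Q L) / card P + card (S - spheres_of Q L) / card S"
  unfolding dist_lin_def
  by (rule cINF_lower[OF bdd_belowI[of _ 0]]) (use assms in auto)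

text \<open>The union bound is applied twice. The first round only secures one common sphere, so its
  \<open>d + 2\<close> points affect the hypothesis alone; the second round, with
  \<open>d + 1\<close> points, yields the error term.\<close>

lemma dist_lin_le_threshold:
  fixes t :: real
  assumes t: "0 \<le> t" "(real CARD('n) + 2) * t < 1"
    and A: "A \<noteq> {}" "\<And>p. p \<in> A \<Longrightarrow> card (missed Q S p) \<le> t * card S"
  shows "dist_lin Q P S \<le> card (P - A) / card P + (real CARD('n) + 1) * t"
proof -
  obtain T where T: "T \<subseteq> A" "finite T" "card T \<le> CARD('n) + 2"
    and TA: "\<And>y. \<forall>p\<in>T. Lam Q p y = 0 \<Longrightarrow> \<forall>p\<in>A. Lam Q p y = 0"
    using Lam_determined_by_few[OF Q, of A] by metis
  have "real (card (\<Union>p\<in>T. missed Q S p)) \<le> (real CARD('n) + 2) * t * card S"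
    using card_missed_by_some_le[of T t "CARD('n) + 2" Q S] T A(2) t(1) by (auto simp: subset_iff add.commute)
  also have "\<dots> < 1 * real (card S)"
    using t card_S by (intro mult_strict_right_mono) auto
  finally have "card (\<Union>p\<in>T. missed Q S p) < card S" by simp
  then have "(\<Union>p\<in>T. missed Q S p) \<noteq> S" by auto
  then obtain s where "s \<in> S" "s \<notin> (\<Union>p\<in>T. missed Q S p)"
    by (auto simp: missed_def)
  then have s: "\<forall>p\<in>A. Lam Q p (lift_sphere Q s) = 0"
    by (intro TA) (auto simp: missed_def)
  then obtain T' where T': "T' \<subseteq> A" "finite T'" "card T' \<le> CARD('n) + 1"
    and T'A: "\<And>y. \<forall>p\<in>T'. Lam Q p y = 0 \<Longrightarrow> \<forall>p\<in>A. Lam Q p y = 0"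
    using Lam_determined_by_fewer[OF Q, of A "lift_sphere Q s"] by metis
  let ?L = "{y. \<forall>p\<in>A. Lam Q p y = 0}"
  have "affine_subspace ?L"
    using affine_subspace_common_zeros[OF Q, of A] s by blast
  \<comment> \<open>This gives both the nonempty base locus, as \<open>A \<noteq> {}\<close>, and
    the bound on the lost points.\<close>
  moreover have AB: "A \<subseteq> base_locus Q ?L"
    by (auto simp: base_locus_def)
  ultimately have "dist_lin Q P S
      \<le> card (P - base_locus Q ?L) / card P + card (S - spheres_of Q ?L) / card S"
    using A(1) by (intro dist_lin_le) auto
  moreover have "card (P - base_locus Q ?L) \<le> card (P - A)"
    using AB by (intro card_mono) auto
  moreover have "real (card (S - spheres_of Q ?L)) \<le> (real CARD('n) + 1) * t * card S"
  proof -
    have "S - spheres_of Q ?L \<subseteq> (\<Union>p\<in>T'. missed Q S p)"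
      using T'A by (fastforce simp: spheres_of_def missed_def simp del: split_paired_All)
    then have "card (S - spheres_of Q ?L) \<le> card (\<Union>p\<in>T'. missed Q S p)"
      by (intro card_mono) auto
    also have "real (card (\<Union>p\<in>T'. missed Q S p)) \<le> (real CARD('n) + 1) * t * card S"
      using card_missed_by_some_le[of T' t "CARD('n) + 1" Q S] T' A(2) t(1) by (auto simp: subset_iff add.commute)
    finally show ?thesis by simp
  qed
  ultimately show ?thesis
    using card_P card_S
    by (smt (verit) divide_right_mono nonzero_mult_div_cancel_right of_nat_0_less_iff of_nat_mono)
qed

lemma dist_lin_upper:
  fixes \<mu> :: real
  defines "d \<equiv> real CARD('n)"
  assumes \<mu>: "\<mu> = (\<Sum>p\<in>P. real (card (missed Q S p))) / (card P * card S)"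
    and small: "\<mu> < (d + 1) / (d + 2)\<^sup>2"
  shows "dist_lin Q P S \<le> 2 * sqrt ((d + 1) * \<mu>)"
proof -
  \<comment> \<open>This \<open>t\<close> balances the two losses: the Markov bound
    \<open>\<mu> / t\<close> equals \<open>(d + 1) * t\<close> when \<open>t > 0\<close>.\<close>
  define t where "t = sqrt (\<mu> / (d + 1))"
  define A where "A = {p \<in> P. card (missed Q S p) \<le> t * card S}"
  have d: "0 \<le> d" by (simp add: d_def)
  have "0 \<le> \<mu>" unfolding \<mu> by (intro divide_nonneg_nonneg sum_nonneg) auto
  then have t0: "0 \<le> t" and t2: "\<mu> = (d + 1) * t\<^sup>2"
    using d by (simp_all add: t_def)
  \<comment> \<open>A restatement of the smallness of \<open>\<mu>\<close>, since
    \<open>\<mu> = (d + 1) * t\<^sup>2\<close>.\<close>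
  have "((d + 2) * t)\<^sup>2 < 1\<^sup>2"
  proof -
    have "(d + 1) * t\<^sup>2 < (d + 1) * (1 / (d + 2)\<^sup>2)"
      using small by (simp add: t2)
    then have "t\<^sup>2 < 1 / (d + 2)\<^sup>2"
      by (rule mult_left_less_imp_less) (use d in simp)
    then show ?thesis
      using d by (simp add: power_mult_distrib pos_less_divide_eq mult.commute)
  qed
  then have dt: "(d + 2) * t < 1"
    by (rule power2_less_imp_less) simp
  have "t * card S * card (P - A) \<le> (\<Sum>p\<in>P. real (card (missed Q S p)))"
  proof -
    have "t * card S * card (P - A) = (\<Sum>p\<in>P - A. t * card S)" by simp
    also have "\<dots> \<le> (\<Sum>p\<in>P - A. real (card (missed Q S p)))"
      by (rule sum_mono) (auto simp: A_def)
    also have "\<dots> \<le> (\<Sum>p\<in>P. real (card (missed Q S p)))"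
      by (rule sum_mono2) auto
    finally show ?thesis .
  qed
  also have "\<dots> = (d + 1) * t\<^sup>2 * (card P * card S)"
    using \<mu> P S by (simp add: t2)
  finally have "card S * (t * card (P - A)) \<le> card S * (t * ((d + 1) * t * card P))"
    by (simp add: power2_eq_square mult_ac)
  then have markov: "t * card (P - A) \<le> t * ((d + 1) * t * card P)"
    by (rule mult_left_le_imp_le) (use card_S in simp)
  have PA: "card (P - A) \<le> (d + 1) * t * card P"
  \<comment> \<open>Markov's inequality says nothing for \<open>t = 0\<close>; then
    \<open>\<mu> = 0\<close>, no point misses a sphere, and \<open>P - A\<close> is empty.\<close>
  proof (cases "t = 0")
    case True
    then have "(\<Sum>p\<in>P. real (card (missed Q S p))) = 0"
      using \<mu> P S by (simp add: t2)
    then have "\<forall>p\<in>P. real (card (missed Q S p)) = 0"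
      by (subst (asm) sum_nonneg_eq_0_iff) auto
    then have "P - A = {}" using True by (auto simp: A_def)
    then show ?thesis using True by (simp only: card.empty)
  next
    case False
    with t0 markov show ?thesis by simp
  qed
  \<comment> \<open>From \<open>(d + 1) * t \<le> (d + 2) * t < 1\<close>; hence
    \<open>P - A\<close> is smaller than \<open>P\<close>.\<close>
  also have "\<dots> < 1 * real (card P)"
    using dt t0 card_P by (intro mult_strict_right_mono) (auto simp: algebra_simps)
  finally have "A \<noteq> {}" by auto
  then have "dist_lin Q P S \<le> card (P - A) / card P + (d + 1) * t"
    unfolding d_def by (intro dist_lin_le_threshold t0 dt[unfolded d_def]) (simp_all add: A_def)
  also have "\<dots> \<le> 2 * ((d + 1) * t)"
    using PA card_P by (simp add: field_simps)
  also have "(d + 1) * t = sqrt ((d + 1) * \<mu>)"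
    unfolding t2 using d t0 by (simp add: real_sqrt_mult power2_eq_square)
  finally show ?thesis .
qed

end

theorem corollary2p10:
  fixes Q :: "'a::finite_field ^ 'n \<Rightarrow> 'a"
    and P :: "('a ^ 'n) set"
    and S :: "(('a ^ 'n) \<times> 'a) set"
    and q d \<mu> :: real
  assumes "q = real CARD('a)" and "odd CARD('a)"
    and "d = real CARD('n)" and "CARD('n) \<ge> 2"
    and "quadratic_form Q" and "nondegenerate_form Q"
    and "P \<noteq> {}" and "S \<noteq> {}"
    and "\<mu> = 1 - real (incidences Q P S) / (real (card P) * real (card S))"
  shows "\<mu> \<le> dist_lin Q P S \<and>
    (\<mu> < (d + 1) / (d + 2)\<^sup>2 \<longrightarrow> dist_lin Q P S \<le> 2 * sqrt ((d + 1) * \<mu>)) \<and>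
    (\<forall>\<eta>::real.
       discrepancy Q P S \<ge> (1 - \<eta>) * (1 - 1 / q) * real (card P) * real (card S) \<longrightarrow>
         \<mu> \<le> \<eta> * (1 - 1 / q) \<and>
         (0 < \<eta> * (1 - 1 / q) \<and> \<eta> * (1 - 1 / q) < (d + 1) / (d + 2)\<^sup>2 \<longrightarrow>
            dist_lin Q P S \<le> 2 * sqrt ((d + 1) * (\<eta> * (1 - 1 / q)))))"
proof -
  note card_pos = card_P[OF assms(5,7,8)] card_S[OF assms(5,7,8)]
  let ?N = "(\<Sum>p\<in>P. real (card (missed Q S p)))"
  have \<mu>: "\<mu> = ?N / (card P * card S)"
    using sum_card_missed[OF assms(5,7,8,2)] assms(7,8,9)
    by (simp add: field_simps)
  have upper: "dist_lin Q P S \<le> 2 * sqrt ((d + 1) * \<mu>)" if "\<mu> < (d + 1) / (d + 2)\<^sup>2"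
    using dist_lin_upper[OF assms(5,7,8) \<mu>] that assms(3) by simp
  have d: "0 \<le> d" using assms(3) by simp
  have \<mu>_le: "\<mu> \<le> \<eta> * (1 - 1 / q)"
    if "discrepancy Q P S \<ge> (1 - \<eta>) * (1 - 1 / q) * real (card P) * real (card S)" for \<eta>
  proof -
    have "(1 - \<eta>) * (1 - 1 / q) * (card P * card S)
        \<le> real (incidences Q P S) - 1 / q * (card P * card S)"
      using that assms(1) by (simp add: discrepancy_def mult.assoc)
    \<comment> \<open>The discrepancy in terms of \<open>\<mu>\<close>; cancelling the positive
      factor \<open>card P * card S\<close> leaves the claim.\<close>
    also have "\<dots> = (1 - \<mu> - 1 / q) * (card P * card S)"
      using assms(7,8,9) by (simp add: field_simps)
    finally have "(1 - \<eta>) * (1 - 1 / q) \<le> 1 - \<mu> - 1 / q"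
      using card_pos by simp
    then show ?thesis by (simp add: left_diff_distrib)
  qed
  \<comment> \<open>Monotonicity of the square root lets any upper estimate of \<open>\<mu>\<close>
    below the threshold replace it, in particular \<open>\<eta> * (1 - 1 / q)\<close>.\<close>
  have "dist_lin Q P S \<le> 2 * sqrt ((d + 1) * x)" if "\<mu> \<le> x" "x < (d + 1) / (d + 2)\<^sup>2" for x
  proof -
    have "dist_lin Q P S \<le> 2 * sqrt ((d + 1) * \<mu>)"
      using that by (intro upper) simp
    also have "\<dots> \<le> 2 * sqrt ((d + 1) * x)"
      using that d by (simp add: mult_left_mono)
    finally show ?thesis .
  qed
  then show ?thesis
    using dist_lin_lower[OF assms(5,7,8)] \<mu> upper \<mu>_le by auto
qed

end
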